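(* Let $X=(X_1,\ldots,X_n)$ be a vector of independent standard normal random variables. Let $h:\mathbb{R}^n\to\mathbb{R}$ and $g:\mathbb{R}\to\mathbb{R}$ be measurable, let $f=g\circ h$, and assume $\mathbb{E}(f(X)^2)<\infty$ and $\mathbb{E}(|X_j h(X)|)<\infty$ for $j=1,\ldots,n$. Let $a=(a_1,\ldots,a_n)^\top\in\mathbb{R}^n$ with $a_j=\mathbb{E}(X_j h(X))$. If $\|a\|=0$ let $U=I$ be the identity matrix; otherwise let $U$ be a Householder reflection of $\mathbb{R}^n$ with $Ue_1=a/\|a\|$. Put $$Y:=\|a\|X_1,\qquad Z:=h(UX)-\|a\|X_1 .$$ Then $$\mathbb{V}(f(UX))=\mathbb{V}\bigl(\mathbb{E}(g(Y+Z)\mid Y)\bigr)+\mathbb{V}\bigl(g(Y+Z)-\mathbb{E}(g(Y+Z)\mid Y)\bigr).$$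
   Context: $\mathbb{E}$ denotes expectation, $\mathbb{V}$ denotes variance, $\|\cdot\|$ is the Euclidean norm, and $e_1=(1,0,\ldots,0)^\top$. A Householder reflection is a matrix of the form $U=I-2\,\frac{vv^\top}{v^\top v}$ with $0\neq v\in\mathbb{R}^n$; it is orthogonal and symmetric. $\mathbb{E}(\cdot\mid Y)$ is conditional expectation given the $\sigma$-algebra generated by $Y$. *)

theory Defs
  imports "HOL-Probability.Probability"
begin

text \<open>
  The dimension \<open>n\<close> is the cardinality of the index type. The linear order on the index type
  only serves to single out the first coordinate.
\<close>

definition e1 :: "real ^ 'n::{finite,linorder}" where
  "e1 = axis (Min UNIV) 1"

text \<open>
  In the following, \<open>columnvector v ** rowvector v\<close> is the outer product of \<open>v\<close> with itself;
  the type annotations fix the inner dimension to be 1.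
\<close>

definition householder :: "real ^ 'n ^ 'n \<Rightarrow> bool" where
  "householder U \<longleftrightarrow> (\<exists>v :: real ^ 'n. v \<noteq> 0 \<and>
     U = mat 1 - (2 / (v \<bullet> v)) *\<^sub>R ((columnvector v :: real ^ 1 ^ 'n) ** (rowvector v :: real ^ 'n ^ 1)))"

definition std_normal_vector :: "'w measure \<Rightarrow> ('w \<Rightarrow> real ^ 'n) \<Rightarrow> bool" where
  "std_normal_vector M X \<longleftrightarrow>
     prob_space.indep_vars M (\<lambda>_. borel) (\<lambda>j \<omega>. X \<omega> $ j) UNIV \<and>
     (\<forall>j. distributed M lborel (\<lambda>\<omega>. X \<omega> $ j) std_normal_density)"

text \<open>A version of the conditional expectation of \<open>W\<close> given the sigma-algebra generated by \<open>Y\<close>.\<close>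

definition cond_exp_given ::
    "'w measure \<Rightarrow> ('w \<Rightarrow> real) \<Rightarrow> ('w \<Rightarrow> real) \<Rightarrow> 'w \<Rightarrow> real" where
  "cond_exp_given M W Y = real_cond_exp M (vimage_algebra (space M) Y borel) W"

end

theory Submission
  imports Defs
begin

text \<open>
  The identity is the law of total variance for \<open>W = f (U X) = g (Y + Z)\<close>: for a square integrable
  \<open>W\<close>, the function \<open>E(W | Y)\<close> is the orthogonal projection of \<open>W\<close> in \<open>L\<^sup>2\<close>, so that
  \<open>W - E(W | Y)\<close> is centred and orthogonal to \<open>E(W | Y)\<close>, and Pythagoras applies
  (\<open>variance_cond_exp_decomposition\<close>).

  What has to be proved is that \<open>W\<close> is square integrable, although only \<open>f X\<close> is assumed to be.
  Because \<open>U\<close> is orthogonal, \<open>U X\<close> has the same law as \<open>X\<close>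
  (\<open>distr_std_normal_vector_orthogonal\<close>): the density of \<open>X\<close> depends on the norm only
  (\<open>distr_std_normal_vector\<close>), and Lebesgue measure is invariant under linear isometries
  (\<open>distr_lborel_orthogonal\<close>). The latter is obtained from the uniqueness of
  translation-invariant measures (\<open>translation_invariant_eq_lborel\<close>): the image of Lebesgue measure
  under a linear isometry is again translation invariant, and it gives the same mass to the unit
  ball, which the isometry preserves.
\<close>

section \<open>Invariance of Lebesgue measure under linear isometries\<close>

text \<open>
  Let \<open>\<lambda>\<close> be Lebesgue measure and \<open>B\<close> the unit ball. Integrate the indicator of \<open>x \<in> A\<close>, \<open>y \<in> B\<close> over
  \<open>\<lambda>(dx) \<mu>(dy)\<close>. Substituting \<open>x + y\<close> for \<open>x\<close> and then \<open>y - x\<close> for \<open>y\<close> exchanges the roles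
  of the two measures. As \<open>B\<close> is symmetric, \<open>\<lambda>(y - B) = \<lambda>(B)\<close>, and the result is
  \<open>\<lambda>(A) \<mu>(B) = \<mu>(A) \<lambda>(B)\<close>. Here \<open>\<mu>(B) = \<lambda>(B)\<close> cancels, being positive and finite.
\<close>

lemma translation_invariant_eq_lborel:
  fixes \<mu> :: "'a::euclidean_space measure"
  assumes sets: "sets \<mu> = sets borel"
    and sf: "sigma_finite_measure \<mu>"
    and inv: "\<And>c. distr \<mu> borel (\<lambda>x. c + x) = \<mu>"
    and ball: "emeasure \<mu> (ball 0 1) = emeasure lborel (ball (0::'a) 1)"
  shows "\<mu> = lborel"
proof (rule measure_eqI)
  show "sets \<mu> = sets lborel" using sets by simp
next
  fix A assume "A \<in> sets \<mu>"
  then have A[measurable]: "A \<in> sets borel" using sets by simp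
  note [measurable_cong] = sets
  interpret \<mu>: sigma_finite_measure \<mu> by fact
  interpret P: pair_sigma_finite lborel \<mu> ..
  define B where "B = (ball 0 1 :: 'a set)"
  have [measurable]: "B \<in> sets borel" by (simp add: B_def)
  have shift_\<mu>: "(\<integral>\<^sup>+y. F y \<partial>\<mu>) = (\<integral>\<^sup>+y. F (c + y) \<partial>\<mu>)"
    if [measurable]: "F \<in> borel_measurable borel" for F :: "'a \<Rightarrow> ennreal" and c
    by (subst inv[of c, symmetric]) (simp add: nn_integral_distr)
  have shift_lborel: "(\<integral>\<^sup>+y. F y \<partial>lborel) = (\<integral>\<^sup>+y. F (c + y) \<partial>lborel)"
    if [measurable]: "F \<in> borel_measurable borel" for F :: "'a \<Rightarrow> ennreal" and c
    by (subst lborel_affine[of 1 c]) (simp_all add: density_1 nn_integral_distr)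
  have ball_eq: "(\<integral>\<^sup>+x. indicator B (y - x) \<partial>lborel) = emeasure lborel B" for y :: 'a
  proof -
    have "(\<integral>\<^sup>+x. indicator B (y - x) \<partial>lborel) = (\<integral>\<^sup>+x. indicator B (y - (y + x)) \<partial>lborel)"
      by (rule shift_lborel) simp
    also have "\<dots> = (\<integral>\<^sup>+x. indicator B x \<partial>lborel)"
      by (intro nn_integral_cong) (simp add: B_def indicator_def)
    finally show ?thesis by simp
  qed
  have "emeasure lborel A * emeasure \<mu> B = (\<integral>\<^sup>+y. (\<integral>\<^sup>+x. indicator A x * indicator B y \<partial>lborel) \<partial>\<mu>)"
    by (simp add: nn_integral_multc nn_integral_cmult sets)
  also have "\<dots> = (\<integral>\<^sup>+y. (\<integral>\<^sup>+x. indicator A (y + x) * indicator B y \<partial>lborel) \<partial>\<mu>)"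
    by (intro nn_integral_cong shift_lborel) simp
  also have "\<dots> = (\<integral>\<^sup>+x. (\<integral>\<^sup>+y. indicator A (y + x) * indicator B y \<partial>\<mu>) \<partial>lborel)"
    by (rule P.Fubini') simp
  also have "\<dots> = (\<integral>\<^sup>+x. (\<integral>\<^sup>+y. indicator A y * indicator B (y - x) \<partial>\<mu>) \<partial>lborel)"
  proof (rule nn_integral_cong)
    fix x :: 'a
    show "(\<integral>\<^sup>+y. indicator A (y + x) * indicator B y \<partial>\<mu>) = (\<integral>\<^sup>+y. indicator A y * indicator B (y - x) \<partial>\<mu>)"
      by (subst (2) shift_\<mu>[where c = x]) (simp_all add: add.commute)
  qed
  also have "\<dots> = (\<integral>\<^sup>+y. (\<integral>\<^sup>+x. indicator A y * indicator B (y - x) \<partial>lborel) \<partial>\<mu>)"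
    by (rule P.Fubini'[symmetric]) simp
  also have "\<dots> = emeasure \<mu> A * emeasure lborel B"
    by (simp add: nn_integral_cmult nn_integral_multc ball_eq sets)
  finally have "emeasure lborel A * emeasure lborel B = emeasure \<mu> A * emeasure lborel B"
    using ball by (simp add: B_def)
  moreover have "emeasure lborel B \<noteq> 0" "emeasure lborel B \<noteq> \<infinity>"
    using emeasure_lborel_ball_finite[of "0::'a" 1] content_ball_pos[of 1 "0::'a"]
    by (auto simp: B_def measure_def)
  ultimately show "emeasure \<mu> A = emeasure lborel A"
    by (metis mult.commute ennreal_mult_cancel_left infinity_ennreal_def)
qed

lemma distr_lborel_orthogonal:
  fixes T :: "'a::euclidean_space \<Rightarrow> 'a"
  assumes T: "orthogonal_transformation T"
  shows "distr lborel borel T = lborel"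
proof (rule translation_invariant_eq_lborel)
  have lin: "linear T" using T by (rule orthogonal_transformation_linear)
  then have [measurable]: "T \<in> borel_measurable borel"
    by (intro borel_measurable_continuous_onI linear_continuous_on) (simp add: linear_conv_bounded_linear)
  have ball: "emeasure (distr lborel borel T) (ball 0 r) = emeasure lborel (ball (0::'a) r)" for r
  proof -
    have "T -` ball 0 r = ball 0 r"
      using orthogonal_transformation_norm[OF T] by auto
    then show ?thesis by (simp add: emeasure_distr)
  qed
  then show "emeasure (distr lborel borel T) (ball 0 1) = emeasure lborel (ball (0::'a) 1)" .
  show "sigma_finite_measure (distr lborel borel T)"
  proof
    show "\<exists>A. countable A \<and> A \<subseteq> sets (distr lborel borel T) \<and>
        \<Union> A = space (distr lborel borel T) \<and> (\<forall>a\<in>A. emeasure (distr lborel borel T) a \<noteq> \<infinity>)"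
      using emeasure_lborel_ball_finite[of "0::'a"]
      by (intro exI[of _ "range (\<lambda>n::nat. ball 0 (real n))"])
         (auto simp: ball less_top intro: reals_Archimedean2)
  qed
  show "distr (distr lborel borel T) borel (\<lambda>x. c + x) = distr lborel borel T" for c
  proof -
    obtain d where d: "c = T d"
      using orthogonal_transformation_surj[OF T] by (metis surjD)
    have "distr (distr lborel borel T) borel (\<lambda>x. c + x) = distr lborel borel (\<lambda>x. T (d + x))"
      by (simp add: distr_distr o_def d linear_add[OF lin])
    also have "\<dots> = distr (distr lborel borel (\<lambda>x. d + x)) borel T"
      by (simp add: distr_distr o_def)
    also have "distr lborel borel (\<lambda>x. d + x) = lborel"
      using lborel_affine[of 1 d] by (simp add: density_1)
    finally show ?thesis .
  qed
qed simp

section \<open>Orthogonal invariance of the standard normal law\<close>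

lemma prod_std_normal_density:
  fixes x :: "real ^ 'n::finite"
  shows "(\<Prod>j\<in>UNIV. std_normal_density (x $ j)) =
    (1 / sqrt (2 * pi)) ^ CARD('n) * exp (- (norm x)\<^sup>2 / 2)"
proof -
  have "(norm x)\<^sup>2 = (\<Sum>j\<in>UNIV. (x $ j)\<^sup>2)"
    by (simp add: norm_vec_def L2_set_def sum_nonneg)
  then show ?thesis
    unfolding std_normal_density_def
    by (simp only: prod.distrib prod_constant exp_sum[symmetric] finite_UNIV
        sum_negf sum_divide_distrib[symmetric] finite minus_divide_left[symmetric])
qed

lemma std_normal_vector_measurable:
  fixes X :: "'w \<Rightarrow> real ^ 'n::finite"
  assumes "std_normal_vector M X"
  shows "X \<in> borel_measurable M"
proof (rule borel_measurable_euclidean_space[THEN iffD2], rule ballI)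
  have "(\<lambda>\<omega>. X \<omega> $ j) \<in> borel_measurable M" for j
    using assms distributed_measurable[of M lborel "\<lambda>\<omega>. X \<omega> $ j"]
    by (auto simp: std_normal_vector_def)
  then show "(\<lambda>\<omega>. X \<omega> \<bullet> b) \<in> borel_measurable M" if "b \<in> Basis" for b
    using that by (auto simp: Basis_vec_def inner_axis)
qed

text \<open>By independence both sides agree on boxes, which form an intersection-stable generator
  of the Borel sets; the density of the right-hand side is the product of the marginal densities.\<close>

lemma distr_std_normal_vector:
  fixes X :: "'w \<Rightarrow> real ^ 'n::finite"
  assumes "prob_space M" and X: "std_normal_vector M X"
  shows "distr M borel X =
    density lborel (\<lambda>x. ennreal ((1 / sqrt (2 * pi)) ^ CARD('n) * exp (- (norm x)\<^sup>2 / 2)))"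
    (is "_ = density _ (\<lambda>x. ennreal (?\<phi> x))")
proof -
  interpret prob_space M by fact
  have ind: "indep_vars (\<lambda>_. borel) (\<lambda>j \<omega>. X \<omega> $ j) UNIV"
    and D: "distributed M lborel (\<lambda>\<omega>. X \<omega> $ j) std_normal_density" for j
    using X by (auto simp: std_normal_vector_def)
  have [measurable]: "X \<in> borel_measurable M"
    by (rule std_normal_vector_measurable[OF X])
  have \<phi>: "ennreal (?\<phi> x) = (\<Prod>j\<in>UNIV. ennreal (std_normal_density (x $ j)))" for x :: "real ^ 'n"
    by (simp only: prod_std_normal_density[symmetric]) (simp add: prod_ennreal)
  let ?E = "range (\<lambda>(l, u). box l u :: (real ^ 'n) set)"
  let ?A = "\<lambda>n::nat. box (- (real n *\<^sub>R One)) (real n *\<^sub>R One) :: (real ^ 'n) set"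
  show ?thesis
  proof (rule measure_eqI_generator_eq)
    show "Int_stable ?E" by (auto simp: Int_stable_def box_Int_box)
    show "?E \<subseteq> Pow UNIV" by simp
    show "sets (distr M borel X) = sigma_sets UNIV ?E"
      and "sets (density lborel (\<lambda>x. ennreal (?\<phi> x))) = sigma_sets UNIV ?E"
      by (simp_all add: borel_eq_box)
    show "range ?A \<subseteq> ?E" "(\<Union>i. ?A i) = UNIV" unfolding UN_box_eq_UNIV by auto
    show "emeasure (distr M borel X) (?A i) \<noteq> \<infinity>" for i by (simp add: emeasure_distr)
    fix S assume "S \<in> ?E"
    then obtain l u where S: "S = box l u" by auto
    have iff: "x \<in> S \<longleftrightarrow> (\<forall>j. x $ j \<in> {l $ j<..<u $ j})" for x
      by (auto simp: S mem_box_cart)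
    have "X -` S \<inter> space M = (\<Inter>j\<in>UNIV. (\<lambda>\<omega>. X \<omega> $ j) -` {l $ j<..<u $ j} \<inter> space M)"
      by (auto simp: iff)
    then have "emeasure (distr M borel X) S =
        prob (\<Inter>j\<in>UNIV. (\<lambda>\<omega>. X \<omega> $ j) -` {l $ j<..<u $ j} \<inter> space M)"
      by (simp add: emeasure_distr S emeasure_eq_measure)
    also have "\<dots> = (\<Prod>j\<in>UNIV. emeasure M ((\<lambda>\<omega>. X \<omega> $ j) -` {l $ j<..<u $ j} \<inter> space M))"
      by (subst indep_varsD_finite[OF ind]) (auto simp: emeasure_eq_measure prod_ennreal)
    also have "\<dots> = (\<Prod>j\<in>UNIV. \<integral>\<^sup>+t. ennreal (std_normal_density t) * indicator {l $ j<..<u $ j} t \<partial>lborel)"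
      by (intro prod.cong refl distributed_emeasure[OF D]) simp
    also have "\<dots> = (\<Prod>b\<in>Basis. \<integral>\<^sup>+t. ennreal (std_normal_density t) * indicator {l \<bullet> b<..<u \<bullet> b} t \<partial>lborel)"
      by (rule prod.reindex_bij_witness[of _ "\<lambda>b. SOME j. b = axis j 1" "\<lambda>j. axis j 1"])
         (auto simp: Basis_vec_def axis_eq_axis inner_axis)
    also have "\<dots> = (\<integral>\<^sup>+x. (\<Prod>b\<in>Basis. ennreal (std_normal_density (x \<bullet> b)) * indicator {l \<bullet> b<..<u \<bullet> b} (x \<bullet> b)) \<partial>lborel)"
      by (rule nn_integral_lborel_prod[symmetric]) auto
    also have "\<dots> = (\<integral>\<^sup>+x. ennreal (?\<phi> x) * indicator S x \<partial>lborel)"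
    proof (intro nn_integral_cong)
      fix x :: "real ^ 'n"
      have "(\<Prod>b\<in>Basis. ennreal (std_normal_density (x \<bullet> b)) * indicator {l \<bullet> b<..<u \<bullet> b} (x \<bullet> b)) =
          (\<Prod>j\<in>UNIV. ennreal (std_normal_density (x $ j)) * indicator {l $ j<..<u $ j} (x $ j))"
        by (rule prod.reindex_bij_witness[of _ "\<lambda>j. axis j 1" "\<lambda>b. SOME j. b = axis j 1"])
           (auto simp: Basis_vec_def axis_eq_axis inner_axis)
      also have "\<dots> = ennreal (?\<phi> x) * (\<Prod>j\<in>UNIV. indicator {l $ j<..<u $ j} (x $ j))"
        by (simp only: prod.distrib \<phi>)
      also have "(\<Prod>j\<in>UNIV. indicator {l $ j<..<u $ j} (x $ j)) = (indicator S x :: ennreal)"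
        by (auto simp: indicator_def iff)
      finally show "(\<Prod>b\<in>Basis. ennreal (std_normal_density (x \<bullet> b)) * indicator {l \<bullet> b<..<u \<bullet> b} (x \<bullet> b)) =
          ennreal (?\<phi> x) * indicator S x" .
    qed
    also have "\<dots> = emeasure (density lborel (\<lambda>x. ennreal (?\<phi> x))) S"
      by (rule emeasure_density[symmetric]) (auto simp: S)
    finally show "emeasure (distr M borel X) S = emeasure (density lborel (\<lambda>x. ennreal (?\<phi> x))) S" .
  qed
qed

lemma distr_std_normal_vector_orthogonal:
  fixes X :: "'w \<Rightarrow> real ^ 'n::finite"
  assumes M: "prob_space M" and X: "std_normal_vector M X"
    and T: "orthogonal_transformation T"
  shows "distr M borel (\<lambda>\<omega>. T (X \<omega>)) = distr M borel X"
proof -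
  have [measurable]: "T \<in> borel_measurable borel"
    using orthogonal_transformation_linear[OF T]
    by (intro borel_measurable_continuous_onI linear_continuous_on) (simp add: linear_conv_bounded_linear)
  have [measurable]: "X \<in> borel_measurable M"
    by (rule std_normal_vector_measurable[OF X])
  let ?\<phi> = "\<lambda>x :: real ^ 'n. ennreal ((1 / sqrt (2 * pi)) ^ CARD('n) * exp (- (norm x)\<^sup>2 / 2))"
  have "distr M borel (\<lambda>\<omega>. T (X \<omega>)) = distr (distr M borel X) borel T"
    by (simp add: distr_distr o_def)
  also have "\<dots> = distr (density lborel (\<lambda>x. ?\<phi> (T x))) borel T"
    by (simp add: distr_std_normal_vector[OF M X] orthogonal_transformation_norm[OF T])
  also have "\<dots> = density (distr lborel borel T) ?\<phi>"
    by (rule density_distr[symmetric]) auto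
  also have "\<dots> = distr M borel X"
    by (simp add: distr_lborel_orthogonal[OF T] distr_std_normal_vector[OF M X])
  finally show ?thesis .
qed

text \<open>The rank-one part acts by \<open>x \<mapsto> (v \<bullet> x) v\<close>, so \<open>U\<close> is the reflection in the hyperplane orthogonal
  to \<open>v\<close> and preserves the inner product.\<close>

lemma householder_orthogonal_transformation:
  assumes "householder U"
  shows "orthogonal_transformation ((*v) U)"
proof -
  obtain v where v: "v \<noteq> 0"
    and U: "U = mat 1 - (2 / (v \<bullet> v)) *\<^sub>R ((columnvector v :: real ^ 1 ^ 'a) ** (rowvector v :: real ^ 'a ^ 1))"
    using assms by (auto simp: householder_def)
  have outer: "((columnvector v :: real ^ 1 ^ 'a) ** (rowvector v :: real ^ 'a ^ 1)) *v x = (v \<bullet> x) *\<^sub>R v" for x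
    by (simp add: vec_eq_iff matrix_vector_mult_def matrix_matrix_mult_def columnvector_def
        rowvector_def inner_vec_def sum_distrib_left sum_distrib_right mult_ac)
  have Ux: "U *v x = x - (2 * (v \<bullet> x) / (v \<bullet> v)) *\<^sub>R v" for x
    by (simp add: U matrix_vector_mult_diff_rdistrib scaleR_matrix_vector_assoc[symmetric] outer)
  have "(U *v x) \<bullet> (U *v y) = x \<bullet> y" for x y
    using v by (simp add: Ux inner_diff_left inner_diff_right inner_commute field_simps)
  then show ?thesis
    by (simp add: orthogonal_transformation_def matrix_vector_mul_linear)
qed

section \<open>Law of total variance\<close>

text \<open>
  The cross term in the expansion of the variance vanishes because \<open>C = E(W | F)\<close>, being
  \<open>F\<close>-measurable, satisfies \<open>E(C W) = E(C C)\<close>; square integrability of \<open>W\<close> passes to \<open>C\<close> by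
  Jensen's inequality.
\<close>

lemma variance_cond_exp_decomposition:
  assumes "prob_space M" and sub: "subalgebra M F"
    and W[measurable]: "W \<in> borel_measurable M" and W2: "integrable M (\<lambda>\<omega>. (W \<omega>)\<^sup>2)"
  shows "prob_space.variance M W =
    prob_space.variance M (real_cond_exp M F W) +
    prob_space.variance M (\<lambda>\<omega>. W \<omega> - real_cond_exp M F W \<omega>)"
proof -
  interpret prob_space M by fact
  interpret finite_measure_subalgebra M F by unfold_locales (rule sub)
  define C where "C = real_cond_exp M F W"
  have [measurable]: "C \<in> borel_measurable M" "C \<in> borel_measurable F" by (simp_all add: C_def)
  have W1: "integrable M W" using W W2 by (rule square_integrable_imp_integrable)
  have C1: "integrable M C" and EC: "expectation C = expectation W"
    using real_cond_exp_int[OF W1] by (simp_all add: C_def)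
  have C2: "integrable M (\<lambda>\<omega>. (C \<omega>)\<^sup>2)"
    unfolding C_def
    by (rule integrable_convex_cond_exp[OF W1, where I = UNIV]) (auto simp: W2 convex_power2)
  have CW: "integrable M (\<lambda>\<omega>. C \<omega> * W \<omega>)"
  proof (rule Bochner_Integration.integrable_bound)
    show "integrable M (\<lambda>\<omega>. (C \<omega>)\<^sup>2 + (W \<omega>)\<^sup>2)" using C2 W2 by simp
    show "AE \<omega> in M. norm (C \<omega> * W \<omega>) \<le> norm ((C \<omega>)\<^sup>2 + (W \<omega>)\<^sup>2)"
    proof (intro AE_I2)
      fix \<omega>
      have "2 * (\<bar>C \<omega>\<bar> * \<bar>W \<omega>\<bar>) \<le> (C \<omega>)\<^sup>2 + (W \<omega>)\<^sup>2"
        using sum_squares_bound[of "\<bar>C \<omega>\<bar>" "\<bar>W \<omega>\<bar>"] by (simp add: mult.assoc)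
      moreover have "0 \<le> \<bar>C \<omega>\<bar> * \<bar>W \<omega>\<bar>" by simp
      ultimately show "norm (C \<omega> * W \<omega>) \<le> norm ((C \<omega>)\<^sup>2 + (W \<omega>)\<^sup>2)"
        unfolding real_norm_def abs_mult by linarith
    qed
  qed simp
  have cross: "expectation (\<lambda>\<omega>. C \<omega> * W \<omega>) = expectation (\<lambda>\<omega>. (C \<omega>)\<^sup>2)"
    using real_cond_exp_intg(2)[OF CW] by (simp add: C_def power2_eq_square)
  have D: "(W \<omega> - C \<omega>)\<^sup>2 = (W \<omega>)\<^sup>2 - 2 * (C \<omega> * W \<omega>) + (C \<omega>)\<^sup>2" for \<omega>
    by (simp add: power2_diff mult_ac)
  have "variance (\<lambda>\<omega>. W \<omega> - C \<omega>) = expectation (\<lambda>\<omega>. (W \<omega>)\<^sup>2) - expectation (\<lambda>\<omega>. (C \<omega>)\<^sup>2)"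
    using W1 C1 W2 C2 CW by (simp add: EC D cross)
  moreover have "variance W = expectation (\<lambda>\<omega>. (W \<omega>)\<^sup>2) - (expectation W)\<^sup>2"
    using W1 W2 by (rule variance_eq)
  moreover have "variance C = expectation (\<lambda>\<omega>. (C \<omega>)\<^sup>2) - (expectation W)\<^sup>2"
    using variance_eq[OF C1 C2] EC by simp
  ultimately show ?thesis by (simp add: C_def)
qed

theorem theorem3p5:
  fixes M :: "'w measure"
    and X :: "'w \<Rightarrow> real ^ ('n::{finite,linorder})"
    and h :: "real ^ ('n::{finite,linorder}) \<Rightarrow> real"
    and g :: "real \<Rightarrow> real"
    and f :: "real ^ ('n::{finite,linorder}) \<Rightarrow> real"
    and a :: "real ^ ('n::{finite,linorder})"
    and U :: "real ^ ('n::{finite,linorder}) ^ ('n::{finite,linorder})"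
    and Y Z :: "'w \<Rightarrow> real"
  assumes "prob_space M"
    and "std_normal_vector M X"
    and "h \<in> borel_measurable borel"
    and "g \<in> borel_measurable borel"
    and "f = g \<circ> h"
    and "integrable M (\<lambda>\<omega>. (f (X \<omega>))\<^sup>2)"
    and "\<And>j. integrable M (\<lambda>\<omega>. \<bar>X \<omega> $ j * h (X \<omega>)\<bar>)"
    and "a = (\<chi> j. prob_space.expectation M (\<lambda>\<omega>. X \<omega> $ j * h (X \<omega>)))"
    and "norm a = 0 \<Longrightarrow> U = mat 1"
    and "norm a \<noteq> 0 \<Longrightarrow> householder U \<and> U *v e1 = a /\<^sub>R norm a"
    and "Y = (\<lambda>\<omega>. norm a * (X \<omega> $ Min UNIV))"
    and "Z = (\<lambda>\<omega>. h (U *v X \<omega>) - norm a * (X \<omega> $ Min UNIV))"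
  shows "prob_space.variance M (\<lambda>\<omega>. f (U *v X \<omega>)) =
      prob_space.variance M (cond_exp_given M (\<lambda>\<omega>. g (Y \<omega> + Z \<omega>)) Y)
    + prob_space.variance M
        (\<lambda>\<omega>. g (Y \<omega> + Z \<omega>) - cond_exp_given M (\<lambda>\<omega>. g (Y \<omega> + Z \<omega>)) Y \<omega>)"
proof -
  interpret prob_space M by fact
  note [measurable] = assms(3,4)
  have X[measurable]: "X \<in> borel_measurable M"
    using assms(2) by (rule std_normal_vector_measurable)
  have f[measurable]: "f \<in> borel_measurable borel" unfolding assms(5) by measurable
  have T: "orthogonal_transformation ((*v) U)"
    using assms(9,10) householder_orthogonal_transformation[of U]
    by (cases "norm a = 0") (auto simp: orthogonal_transformation_def linear_id[unfolded id_def])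
  have UX[measurable]: "(\<lambda>\<omega>. U *v X \<omega>) \<in> borel_measurable M"
    by (rule borel_measurable_continuous_on[OF _ X]) (intro matrix_vector_mult_linear_continuous_on)
  define W where "W = (\<lambda>\<omega>. f (U *v X \<omega>))"
  have W[measurable]: "W \<in> borel_measurable M" unfolding W_def by measurable
  have eq: "g (Y \<omega> + Z \<omega>) = W \<omega>" "f (U *v X \<omega>) = W \<omega>" for \<omega>
    by (simp_all add: W_def assms(5,11,12))
  \<comment> \<open>Square integrability depends on the law only, and \<open>U X\<close> has the law of \<open>X\<close>.\<close>
  have "integrable (distr M borel X) (\<lambda>x. (f x)\<^sup>2)"
    using assms(6) by (simp add: integrable_distr_eq)
  then have "integrable (distr M borel (\<lambda>\<omega>. U *v X \<omega>)) (\<lambda>x. (f x)\<^sup>2)"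
    using distr_std_normal_vector_orthogonal[OF assms(1,2) T] by simp
  then have W2: "integrable M (\<lambda>\<omega>. (W \<omega>)\<^sup>2)"
    by (simp add: integrable_distr_eq W_def)
  have "Y \<in> borel_measurable M"
    unfolding assms(11)
    by (rule borel_measurable_continuous_on[OF _ X]) (intro continuous_intros)
  then have "subalgebra M (vimage_algebra (space M) Y borel)"
    by (auto simp: subalgebra_def sets_vimage_algebra2 intro: measurable_sets)
  then have "variance W = variance (cond_exp_given M W Y) + variance (\<lambda>\<omega>. W \<omega> - cond_exp_given M W Y \<omega>)"
    unfolding cond_exp_given_def using assms(1) W W2 by (intro variance_cond_exp_decomposition)
  then show ?thesis
    by (simp only: eq)
qed

end
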